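(* Let $p\ge 1$ be an integer and let $\boldsymbol{\beta}=(\beta_0,\ldots,\beta_{p-1})$ be a $p$-tuple of real numbers greater than $1$. The density $\frac{d\mu_{\boldsymbol{\beta}}}{d\lambda_p}$ of $\mu_{\boldsymbol{\beta}}$ with respect to the $p$-Lebesgue measure $\lambda_p$ on $\mathcal{T}_p$ is $$\sum_{i=0}^{p-1}\Big(\frac{d\mu_{\boldsymbol{\beta},i}}{d\lambda}\circ\pi_2\Big)\cdot\chi_{\{i\}\times[0,1)}.$$
   Context: Convention: for $n\in\mathbb{Z}$, $\beta_n=\beta_{n\bmod p}$. For a real $\beta>1$, $T_\beta\colon[0,1)\to[0,1)$, $x\mapsto \beta x-\lfloor\beta x\rfloor$. The map $\pi_2$ is $(n,x)\mapsto x$ and $\chi_E$ is the indicator function of $E$. $\mathcal{B}(A)$ denotes the Borel $\sigma$-algebra of $A\subset\mathbb{R}$ and $\lambda$ the Lebesgue measure. $\mathcal{T}_p$ is the $\sigma$-algebra on $\{0,\ldots,p-1\}\times[0,1)$ of all sets $\bigcup_{i=0}^{p-1}(\{i\}\times B_i)$ with $B_i\in\mathcal{B}([0,1))$ for all $i$. The $p$-Lebesgue measure $\lambda_p$ on $\mathcal{T}_p$ is $\lambda_p\big(\bigcup_{i=0}^{p-1}(\{i\}\times B_i)\big)=\frac1p\sum_{i=0}^{p-1}\lambda(B_i)$. For each $i\in\{0,\ldots,p-1\}$, $\mu_{\boldsymbol{\beta},i}$ denotes the unique probability measure on $\mathcal{B}([0,1))$ that is absolutely continuous with respect to $\lambda$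 and invariant under $T_{\beta_{i-1}}\circ\cdots\circ T_{\beta_{i-p}}$ (existence and uniqueness hold), and $\frac{d\mu_{\boldsymbol{\beta},i}}{d\lambda}$ is its density (Radon–Nikodym derivative). The measure $\mu_{\boldsymbol{\beta}}$ on $\mathcal{T}_p$ is $\mu_{\boldsymbol{\beta}}\big(\bigcup_{i=0}^{p-1}(\{i\}\times B_i)\big)=\frac1p\sum_{i=0}^{p-1}\mu_{\boldsymbol{\beta},i}(B_i)$. *)

theory Defs
  imports "HOL-Probability.Probability"
begin

definition lebesgue01 :: "real measure" where
  "lebesgue01 = restrict_space lborel {0..<1}"

(* Only the values beta 0, ..., beta (p - 1) matter: this is the p-periodic
   extension of the p-tuple to all integer indices. *)
definition beta_per :: "nat \<Rightarrow> (nat \<Rightarrow> real) \<Rightarrow> int \<Rightarrow> real" where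
  "beta_per p \<beta> n = \<beta> (nat (n mod int p))"

definition T :: "real \<Rightarrow> real \<Rightarrow> real" where
  "T b x = b * x - of_int \<lfloor>b * x\<rfloor>"

(* T_comp p beta i k is T_(beta_(i-1)) o ... o T_(beta_(i-k)); the factor with index i - k
   is applied first. *)
primrec T_comp :: "nat \<Rightarrow> (nat \<Rightarrow> real) \<Rightarrow> int \<Rightarrow> nat \<Rightarrow> real \<Rightarrow> real" where
  "T_comp p \<beta> i 0 = id"
| "T_comp p \<beta> i (Suc k) = T_comp p \<beta> i k \<circ> T (beta_per p \<beta> (i - int (Suc k)))"

definition invariant_under :: "'a measure \<Rightarrow> ('a \<Rightarrow> 'a) \<Rightarrow> bool" where
  "invariant_under M F \<longleftrightarrow>
     F \<in> measurable M M \<and> (\<forall>B\<in>sets M. emeasure M (F -` B \<inter> space M) = emeasure M B)"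

(* The property that singles out the measure of index i among the measures on the
   Borel sets of [0,1). *)
definition is_mu :: "nat \<Rightarrow> (nat \<Rightarrow> real) \<Rightarrow> nat \<Rightarrow> real measure \<Rightarrow> bool" where
  "is_mu p \<beta> i M \<longleftrightarrow>
     sets M = sets (restrict_space borel {0..<1}) \<and>
     prob_space M \<and>
     absolutely_continuous lebesgue01 M \<and>
     invariant_under M (T_comp p \<beta> (int i) p)"

definition Tp :: "nat \<Rightarrow> (nat \<times> real) set set" where
  "Tp p = {(\<Union>i<p. {i} \<times> B i) | B. \<forall>i<p. B i \<in> sets (restrict_space borel {0..<1})}"

(* For E = (UN i<p. {i} x B i), the fibre Pair i -` E is B i; see emeasure_fibre_average. *)
definition fibre_average :: "nat \<Rightarrow> (nat \<Rightarrow> real measure) \<Rightarrow> (nat \<times> real) measure" where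
  "fibre_average p M =
     measure_of ({..<p} \<times> {0..<1}) (Tp p)
       (\<lambda>E. (\<Sum>i<p. emeasure (M i) (Pair i -` E)) / of_nat p)"

definition lambda_p :: "nat \<Rightarrow> (nat \<times> real) measure" where
  "lambda_p p = fibre_average p (\<lambda>i. lebesgue01)"

lemma Tp_iff:
  "E \<in> Tp p \<longleftrightarrow> E \<subseteq> {..<p} \<times> {0..<1} \<and>
     (\<forall>i<p. Pair i -` E \<in> sets (restrict_space borel {0..<1}))"
proof
  assume "E \<in> Tp p"
  then obtain B where E: "E = (\<Union>i<p. {i} \<times> B i)"
    and B: "\<forall>i<p. B i \<in> sets (restrict_space borel {0..<1::real})"
    by (auto simp: Tp_def)
  have fib: "Pair i -` E = B i" if "i < p" for i
    using that by (auto simp: E)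
  have sub: "B i \<subseteq> {0..<1}" if "i < p" for i
    using sets.sets_into_space[OF B[rule_format, OF that]] by (simp add: space_restrict_space)
  have "E \<subseteq> {..<p} \<times> {0..<1}"
    unfolding E by (intro UN_least Sigma_mono sub) auto
  with B show "E \<subseteq> {..<p} \<times> {0..<1} \<and>
     (\<forall>i<p. Pair i -` E \<in> sets (restrict_space borel {0..<1}))"
    by (simp add: fib)
next
  assume *: "E \<subseteq> {..<p} \<times> {0..<1} \<and>
     (\<forall>i<p. Pair i -` E \<in> sets (restrict_space borel {0..<1}))"
  then have "E = (\<Union>i<p. {i} \<times> (Pair i -` E))"
    by blast
  with * show "E \<in> Tp p"
    unfolding Tp_def by (intro CollectI exI[of _ "\<lambda>i. Pair i -` E"]) simp
qed

lemma sigma_algebra_Tp: "sigma_algebra ({..<p} \<times> {0..<1}) (Tp p)"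
  unfolding sigma_algebra_iff2
proof (intro conjI ballI allI impI)
  show "Tp p \<subseteq> Pow ({..<p} \<times> {0..<1})"
    using Tp_iff by blast
  show "{} \<in> Tp p"
    by (auto simp: Tp_iff)
next
  fix E assume E: "E \<in> Tp p"
  have "Pair i -` ({..<p} \<times> {0..<1} - E) \<in> sets (restrict_space borel {0..<1})" if "i < p" for i
  proof -
    have "Pair i -` ({..<p} \<times> {0..<1} - E) = space (restrict_space borel {0..<1}) - Pair i -` E"
      using that by (auto simp: space_restrict_space)
    moreover have "Pair i -` E \<in> sets (restrict_space borel {0..<1})"
      using E that by (simp add: Tp_iff)
    ultimately show ?thesis
      by (simp only: sets.compl_sets)
  qed
  then show "{..<p} \<times> {0..<1} - E \<in> Tp p"
    unfolding Tp_iff by blast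
next
  fix A :: "nat \<Rightarrow> _" assume A: "range A \<subseteq> Tp p"
  then have "A n \<in> Tp p" for n by auto
  then have "A n \<subseteq> {..<p} \<times> {0..<1}"
    and "i < p \<Longrightarrow> Pair i -` A n \<in> sets (restrict_space borel {0..<1})" for n i
    unfolding Tp_iff by blast+
  then show "(\<Union>n. A n) \<in> Tp p"
    unfolding Tp_iff vimage_UN by (intro conjI UN_least allI impI sets.countable_UN) auto
qed

lemma sets_fibre_average: "sets (fibre_average p M) = Tp p"
  and space_fibre_average: "space (fibre_average p M) = {..<p} \<times> {0..<1}"
proof -
  interpret sigma_algebra "{..<p} \<times> {0..<1::real}" "Tp p" by (rule sigma_algebra_Tp)
  show "sets (fibre_average p M) = Tp p"
    unfolding fibre_average_def by (simp add: space_closed)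
  show "space (fibre_average p M) = {..<p} \<times> {0..<1}"
    unfolding fibre_average_def by (simp add: space_closed)
qed

lemma emeasure_fibre_average:
  assumes M: "\<And>i. i < p \<Longrightarrow> sets (M i) = sets (restrict_space borel {0..<1})"
    and B: "\<And>i. i < p \<Longrightarrow> B i \<in> sets (restrict_space borel {0..<1})"
  shows "emeasure (fibre_average p M) (\<Union>i<p. {i} \<times> B i) =
    (\<Sum>i<p. emeasure (M i) (B i)) / of_nat p"
proof -
  interpret sigma_algebra "{..<p} \<times> {0..<1::real}" "Tp p" by (rule sigma_algebra_Tp)
  let ?m = "\<lambda>E. (\<Sum>i<p. emeasure (M i) (Pair i -` E)) / of_nat p :: ennreal"
  have "countably_additive (Tp p) ?m"
    unfolding countably_additive_def
  proof (intro allI impI)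
    fix A :: "nat \<Rightarrow> _"
    assume A: "range A \<subseteq> Tp p" and disj: "disjoint_family A"
    have "(\<Sum>n. emeasure (M i) (Pair i -` A n)) = emeasure (M i) (Pair i -` (\<Union>n. A n))"
      if "i < p" for i
    proof -
      have "A n \<in> Tp p" for n using A by auto
      then have "range (\<lambda>n. Pair i -` A n) \<subseteq> sets (M i)"
        using that by (auto simp: Tp_iff M)
      moreover have "disjoint_family (\<lambda>n. Pair i -` A n)"
        using disj by (auto simp: disjoint_family_on_def)
      ultimately show ?thesis
        by (simp add: suminf_emeasure vimage_UN)
    qed
    moreover have "(\<Sum>n. ?m (A n)) = (\<Sum>i<p. \<Sum>n. emeasure (M i) (Pair i -` A n)) / of_nat p"
      by (simp add: divide_ennreal_def suminf_sum)
    ultimately show "(\<Sum>n. ?m (A n)) = ?m (\<Union>n. A n)"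
      by simp
  qed
  moreover have "positive (Tp p) ?m"
    by (simp add: positive_def)
  moreover have "(\<Union>i<p. {i} \<times> B i) \<in> Tp p"
    using B by (auto simp: Tp_def)
  ultimately have "emeasure (fibre_average p M) (\<Union>i<p. {i} \<times> B i) = ?m (\<Union>i<p. {i} \<times> B i)"
    unfolding fibre_average_def by (intro emeasure_measure_of_sigma sigma_algebra_axioms)
  moreover have "Pair i -` (\<Union>i<p. {i} \<times> B i) = B i" if "i < p" for i
    using that by auto
  ultimately show ?thesis
    by simp
qed

end

theory Submission
  imports Defs
begin

text \<open>The space is a disjoint union of \<open>p\<close> copies of [0,1), and both measures
  average measures living on these copies, so everything can be checked fibre by fibre. On fibre i,
  Radon-Nikodym gives \<open>\<mu> i\<close> the density
  \<open>RN_deriv lebesgue01 (\<mu> i)\<close>; glued together, these densities form the function f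
  of the theorem. The bridge is a Fubini-type formula, \<open>nn_integral_fibre_average\<close>:
  integrating against \<open>fibre_average p M\<close> means averaging the integrals over the
  fibres. Applied to f times the indicator of A = (UN i<p. {i} x B i), it gives the average of the
  values \<open>emeasure (\<mu> i) (B i)\<close>, which is the mass of A under
  \<open>fibre_average p \<mu>\<close>. Uniqueness of densities over the finite measure
  \<open>lambda_p p\<close> then identifies f with the Radon-Nikodym derivative almost
  everywhere.\<close>

text \<open>The sigma-algebra is \<open>Tp p\<close> whatever M is, and membership in
  \<open>Tp p\<close> is decided on fibres; the fibre of a preimage under f is the preimage under
  the section of f.\<close>

lemma borel_measurable_fibre_average_iff:
  fixes f :: "nat \<times> real \<Rightarrow> 'b::topological_space"
  shows "f \<in> borel_measurable (fibre_average p M) \<longleftrightarrow>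
    (\<forall>i<p. (\<lambda>x. f (i, x)) \<in> borel_measurable (restrict_space borel {0..<1}))"
proof -
  have "f -` S \<inter> {..<p} \<times> {0..<1} \<in> Tp p \<longleftrightarrow>
      (\<forall>i<p. (\<lambda>x. f (i, x)) -` S \<inter> {0..<1} \<in> sets (restrict_space borel {0..<1}))" for S
  proof -
    have "Pair i -` (f -` S \<inter> {..<p} \<times> {0..<1}) = (\<lambda>x. f (i, x)) -` S \<inter> {0..<1}"
      if "i < p" for i
      using that by auto
    then show ?thesis
      by (simp add: Tp_iff)
  qed
  then show ?thesis
    unfolding measurable_def
    by (auto simp: sets_fibre_average space_fibre_average space_restrict_space)
qed

text \<open>Holds for indicators by \<open>emeasure_fibre_average\<close>, and both sides respect
  scaling, sums and increasing limits, so induction over nonnegative measurable functions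
  applies.\<close>

lemma nn_integral_fibre_average:
  assumes M: "\<And>i. i < p \<Longrightarrow> sets (M i) = sets (restrict_space borel {0..<1})"
    and f: "f \<in> borel_measurable (fibre_average p M)"
  shows "(\<integral>\<^sup>+z. f z \<partial>fibre_average p M) = (\<Sum>i<p. \<integral>\<^sup>+x. f (i, x) \<partial>M i) / of_nat p"
  using f
proof (induction rule: borel_measurable_induct)
  have meas: "(\<lambda>x. g (i, x)) \<in> borel_measurable (M i)"
    if "g \<in> borel_measurable (fibre_average p M)" "i < p" for g :: "nat \<times> real \<Rightarrow> ennreal" and i
    using that by (simp add: borel_measurable_fibre_average_iff measurable_cong_sets[OF M refl])
  have space: "space (M i) = {0..<1}" if "i < p" for i
    using sets_eq_imp_space_eq[OF M[OF that]] by (simp add: space_restrict_space)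
  {
    case (cong f g)
    have "(\<integral>\<^sup>+x. f (i, x) \<partial>M i) = (\<integral>\<^sup>+x. g (i, x) \<partial>M i)" if "i < p" for i
      using that cong(3) by (intro nn_integral_cong) (simp add: space space_fibre_average)
    moreover have "(\<integral>\<^sup>+z. f z \<partial>fibre_average p M) = (\<integral>\<^sup>+z. g z \<partial>fibre_average p M)"
      using cong(3) by (rule nn_integral_cong)
    ultimately show ?case
      using cong(4) by simp
  next
    case (set A)
    then have "A \<in> Tp p"
      by (simp add: sets_fibre_average)
    then obtain B where A: "A = (\<Union>i<p. {i} \<times> B i)"
      and B: "\<And>i. i < p \<Longrightarrow> B i \<in> sets (restrict_space borel {0..<1})"
      by (auto simp: Tp_def)
    have "(\<lambda>x. indicator A (i, x) :: ennreal) = indicator (B i)" if "i < p" for i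
      using that by (auto simp: A indicator_def)
    moreover have "emeasure (fibre_average p M) A = (\<Sum>i<p. emeasure (M i) (B i)) / of_nat p"
      unfolding A using M B by (rule emeasure_fibre_average)
    ultimately show ?case
      using set B by (simp add: M)
  next
    case (mult u c)
    then show ?case
      by (simp add: nn_integral_cmult meas sum_distrib_left ennreal_times_divide)
  next
    case (add u v)
    then show ?case
      by (simp add: nn_integral_add meas sum.distrib add_divide_distrib_ennreal)
  next
    case (seq U)
    have inc: "incseq (\<lambda>n x. U n (i, x))" for i
      using seq(3) by (auto simp: incseq_def le_fun_def)
    have "(\<integral>\<^sup>+z. (SUP n. U n) z \<partial>fibre_average p M) =
        (SUP n. \<integral>\<^sup>+z. U n z \<partial>fibre_average p M)"
      using seq by (simp add: nn_integral_monotone_convergence_SUP image_comp)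
    also have "\<dots> = (SUP n. (\<Sum>i<p. \<integral>\<^sup>+x. U n (i, x) \<partial>M i)) / of_nat p"
      by (simp add: seq SUP_divide_ennreal)
    \<comment> \<open>Supremum and finite sum commute because each fibre integral increases with
      n.\<close>
    also have "(SUP n. (\<Sum>i<p. \<integral>\<^sup>+x. U n (i, x) \<partial>M i)) =
        (\<Sum>i<p. SUP n. \<integral>\<^sup>+x. U n (i, x) \<partial>M i)"
      using inc by (intro ennreal_SUP_sum incseq_nn_integral) auto
    also have "\<dots> = (\<Sum>i<p. \<integral>\<^sup>+x. (SUP n. U n) (i, x) \<partial>M i)"
      using seq(1) inc
      by (intro sum.cong refl)
        (simp add: nn_integral_monotone_convergence_SUP meas image_comp)
    finally show ?case .
  }
qed

theorem proposition28:
  fixes p :: nat and \<beta> :: "nat \<Rightarrow> real" and \<mu> :: "nat \<Rightarrow> real measure"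
  assumes "p \<ge> 1"
    and "\<And>i. i < p \<Longrightarrow> \<beta> i > 1"
    and "\<And>i. i < p \<Longrightarrow> is_mu p \<beta> i (\<mu> i)"
  shows "let f = (\<lambda>z. \<Sum>i<p. RN_deriv lebesgue01 (\<mu> i) (snd z) * indicator ({i} \<times> {0..<1}) z) in
    f \<in> borel_measurable (lambda_p p) \<and>
    density (lambda_p p) f = fibre_average p \<mu> \<and>
    (AE z in lambda_p p. RN_deriv (lambda_p p) (fibre_average p \<mu>) z = f z)"
proof -
  define f where "f = (\<lambda>z. \<Sum>i<p. RN_deriv lebesgue01 (\<mu> i) (snd z) * indicator ({i} \<times> {0..<1}) z)"
  have sets_leb: "sets lebesgue01 = sets (restrict_space borel {0..<1})"
    by (simp add: lebesgue01_def sets_restrict_space)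
  have space_leb: "space lebesgue01 = {0..<1}"
    by (simp add: lebesgue01_def space_restrict_space)
  have sets_mu: "sets (\<mu> i) = sets (restrict_space borel {0..<1})" if "i < p" for i
    using assms(3)[OF that] by (simp add: is_mu_def)
  have "emeasure lebesgue01 (space lebesgue01) = 1"
    by (simp add: lebesgue01_def space_restrict_space emeasure_restrict_space)
  then interpret leb: finite_measure lebesgue01
    by (intro finite_measureI) simp
  \<comment> \<open>Radon-Nikodym on one fibre: absolute continuity comes from \<open>is_mu\<close>,
    finiteness of the reference measure from \<open>leb\<close>.\<close>
  have dens: "density lebesgue01 (RN_deriv lebesgue01 (\<mu> i)) = \<mu> i" if "i < p" for i
    using assms(3)[OF that] by (intro leb.density_RN_deriv) (simp_all add: is_mu_def sets_leb)
  \<comment> \<open>On fibre i only the i-th indicator survives. Outside [0,1) f vanishes, so the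
    equality is claimed, and later used, only on the space of \<open>lebesgue01\<close>.\<close>
  have fib: "f (i, x) = RN_deriv lebesgue01 (\<mu> i) x" if "i < p" "x \<in> {0..<1}" for i x
    using that by (simp add: f_def indicator_def sum.delta' if_distrib[of "(*) _"] cong: if_cong)
  have meas: "f \<in> borel_measurable (lambda_p p)"
    unfolding lambda_p_def borel_measurable_fibre_average_iff
  proof (intro allI impI)
    fix i assume "i < p"
    then have "(\<lambda>x. f (i, x)) \<in> borel_measurable lebesgue01 \<longleftrightarrow>
        RN_deriv lebesgue01 (\<mu> i) \<in> borel_measurable lebesgue01"
      by (intro measurable_cong) (simp add: fib space_leb)
    then show "(\<lambda>x. f (i, x)) \<in> borel_measurable (restrict_space borel {0..<1})"
      using borel_measurable_RN_deriv[of lebesgue01 "\<mu> i"]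
      by (simp add: measurable_cong_sets[OF sets_leb refl])
  qed
  have density: "density (lambda_p p) f = fibre_average p \<mu>"
  proof (rule measure_eqI)
    show "sets (density (lambda_p p) f) = sets (fibre_average p \<mu>)"
      by (simp add: lambda_p_def sets_fibre_average)
  next
    fix A assume "A \<in> sets (density (lambda_p p) f)"
    then have A: "A \<in> sets (lambda_p p)"
      by simp
    then have "A \<in> Tp p"
      by (simp add: lambda_p_def sets_fibre_average)
    then obtain B where AB: "A = (\<Union>i<p. {i} \<times> B i)"
      and B: "\<And>i. i < p \<Longrightarrow> B i \<in> sets (restrict_space borel {0..<1})"
      by (auto simp: Tp_def)
    \<comment> \<open>Along fibre i the indicator of A becomes that of \<open>B i\<close>, leaving
      the integral of the fibre density over \<open>B i\<close>.\<close>
    have "(\<integral>\<^sup>+x. f (i, x) * indicator A (i, x) \<partial>lebesgue01) = emeasure (\<mu> i) (B i)"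
      if "i < p" for i
    proof -
      have "(\<integral>\<^sup>+x. f (i, x) * indicator A (i, x) \<partial>lebesgue01) =
          (\<integral>\<^sup>+x. RN_deriv lebesgue01 (\<mu> i) x * indicator (B i) x \<partial>lebesgue01)"
        using that by (intro nn_integral_cong) (auto simp: fib space_leb AB indicator_def)
      also have "\<dots> = emeasure (density lebesgue01 (RN_deriv lebesgue01 (\<mu> i))) (B i)"
        using B[OF that] by (simp add: emeasure_density sets_leb)
      finally show ?thesis
        by (simp add: dens that)
    qed
    moreover have "(\<lambda>z. f z * indicator A z) \<in> borel_measurable (fibre_average p (\<lambda>i. lebesgue01))"
      using meas A unfolding lambda_p_def by measurable
    ultimately have "(\<integral>\<^sup>+z. f z * indicator A z \<partial>lambda_p p) = (\<Sum>i<p. emeasure (\<mu> i) (B i)) / of_nat p"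
      unfolding lambda_p_def by (simp add: nn_integral_fibre_average sets_leb)
    moreover have "emeasure (fibre_average p \<mu>) A = (\<Sum>i<p. emeasure (\<mu> i) (B i)) / of_nat p"
      unfolding AB using sets_mu B by (rule emeasure_fibre_average)
    ultimately show "emeasure (density (lambda_p p) f) A = emeasure (fibre_average p \<mu>) A"
      by (simp add: emeasure_density meas A)
  qed
  \<comment> \<open>The total mass is the integral of 1, an average of finite masses with nonzero
    divisor since \<open>p \<ge> 1\<close>. Finiteness is what allows uniqueness of the derivative
    to be invoked.\<close>
  have "(\<integral>\<^sup>+z. 1 \<partial>lambda_p p) = (\<Sum>i<p. \<integral>\<^sup>+x. 1 \<partial>lebesgue01) / of_nat p"
    unfolding lambda_p_def by (rule nn_integral_fibre_average) (simp_all add: sets_leb)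
  then have "emeasure (lambda_p p) (space (lambda_p p)) \<noteq> \<infinity>"
    using assms(1) leb.emeasure_finite
    by (simp add: ennreal_divide_eq_top_iff ennreal_mult_eq_top_iff)
  then interpret lam: finite_measure "lambda_p p"
    by (rule finite_measureI)
  have "AE z in lambda_p p. RN_deriv (lambda_p p) (fibre_average p \<mu>) z = f z"
    using lam.RN_deriv_unique[OF meas density] by eventually_elim simp
  with meas density show ?thesis
    by (simp add: f_def Let_def)
qed

end
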